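(* Let $t$ be even. Given two sets $A,B$ of $N$ tensors in $\{0,1\}^{2\times\cdots\times2}$ ($t$ factors) such that every tensor in $B$ is max-invariant, there is a deterministic algorithm running in $O(N\,\mathrm{poly}(2^t))$ time that outputs a set $A'$ of $N$ regular expressions of length $\mathrm{poly}(2^t)$ and a set $B'$ of $N$ strings of length $2^t$, all over the alphabet $\{0,1,\bot\}$, together with a correspondence $a\mapsto a'\in A'$, $b\mapsto b'\in B'$, such that $\mathrm{MaxSim}(a',b')=s(a,b)$ for all $a\in A$, $b\in B$.
   Context: Tensors indexed by $i=(i_1,\dots,i_t)\in\{0,1\}^t$; tropical similarity $s(u,v)=\mathbb{E}_{i_1}\max_{i_2}\mathbb{E}_{i_3}\cdots\max_{i_t}(u_i\cdot v_i)$, $\mathbb{E}$ the average over $\{0,1\}$. A tensor $x$ is max-invariant if $x_{i}$ does not depend on $i_2,i_4,\dots,i_t$. Regular expressions over an alphabet $\Sigma$ are built from symbols by concatenation, alternation $[R\mid S]$, $[R]^+$ and $[R]^*$, with the usual language $L(\cdot)$. For equal-length strings $x,y$ of length $m$, $\mathrm{HamSim}(x,y)=\frac1m\#\{j:x_j=y_j\}$; for a regular expression $a$ and string $b$, $\mathrm{MaxSim}(a,b)=\max\{\mathrm{HamSim}(x,b):x\in L(a),|x|=|b|\}$. *)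

theory Defs
  imports Complex_Main "HOL-Library.FuncSet"
begin

definition indices :: "nat \<Rightarrow> nat list set" where
  "indices t = {i. length i = t \<and> set i \<subseteq> {0, 1}}"

text \<open>Extensional functions, so that distinct members really are distinct tensors.\<close>

definition tensors :: "nat \<Rightarrow> (nat list \<Rightarrow> nat) set" where
  "tensors t = indices t \<rightarrow>\<^sub>E {0, 1}"

text \<open>\<open>avg_level t w\<close> is the alternating expression in \<open>t\<close> index coordinates that starts
  with an average, \<open>max_level t w\<close> the one that starts with a maximum.\<close>

fun avg_level :: "nat \<Rightarrow> (nat list \<Rightarrow> real) \<Rightarrow> real"
  and max_level :: "nat \<Rightarrow> (nat list \<Rightarrow> real) \<Rightarrow> real" where
  "avg_level 0 w = w []"
| "avg_level (Suc n) w = (max_level n (\<lambda>i. w (0 # i)) + max_level n (\<lambda>i. w (1 # i))) / 2"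
| "max_level 0 w = w []"
| "max_level (Suc n) w = max (avg_level n (\<lambda>i. w (0 # i))) (avg_level n (\<lambda>i. w (1 # i)))"

definition trop_sim :: "nat \<Rightarrow> (nat list \<Rightarrow> nat) \<Rightarrow> (nat list \<Rightarrow> nat) \<Rightarrow> real" where
  "trop_sim t u v = avg_level t (\<lambda>i. real (u i * v i))"

text \<open>List positions count from 0, so the coordinates \<open>i\<^sub>1, i\<^sub>3, \<dots>\<close> sit at the even positions.\<close>

definition max_invariant :: "nat \<Rightarrow> (nat list \<Rightarrow> nat) \<Rightarrow> bool" where
  "max_invariant t x \<longleftrightarrow>
     (\<forall>i \<in> indices t. \<forall>j \<in> indices t. (\<forall>k < t. even k \<longrightarrow> i ! k = j ! k) \<longrightarrow> x i = x j)"

datatype letter = L0 | L1 | LBot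

datatype 'a regex =
    Sym 'a
  | Cat "'a regex" "'a regex"
  | Alt "'a regex" "'a regex"
  | Plus "'a regex"
  | Star "'a regex"

fun lang :: "'a regex \<Rightarrow> 'a list set" where
  "lang (Sym c) = {[c]}"
| "lang (Cat r s) = {x @ y | x y. x \<in> lang r \<and> y \<in> lang s}"
| "lang (Alt r s) = lang r \<union> lang s"
| "lang (Plus r) = {concat xs | xs. xs \<noteq> [] \<and> set xs \<subseteq> lang r}"
| "lang (Star r) = {concat xs | xs. set xs \<subseteq> lang r}"

definition HamSim :: "'a list \<Rightarrow> 'a list \<Rightarrow> real" where
  "HamSim x y = real (card {j. j < length x \<and> x ! j = y ! j}) / real (length x)"

text \<open>Meaningful only if \<open>lang a\<close> contains a word of length \<open>length b\<close>.\<close>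

definition MaxSim :: "'a regex \<Rightarrow> 'a list \<Rightarrow> real" where
  "MaxSim a b = Max {HamSim x b | x. x \<in> lang a \<and> length x = length b}"

text \<open>\<open>ItemEnd\<close> terminates every item of a list and \<open>ListEnd\<close> separates the two lists that
  form an input or an output.\<close>

datatype token = Letter letter | LBrack | Bar | RBrack | PlusSign | StarSign | ItemEnd | ListEnd

text \<open>The written form of an expression: concatenation is juxtaposition, hence the text
  determines the expression up to associativity of concatenation.\<close>

fun regex_text :: "letter regex \<Rightarrow> token list" where
  "regex_text (Sym c) = [Letter c]"
| "regex_text (Cat r s) = regex_text r @ regex_text s"
| "regex_text (Alt r s) = [LBrack] @ regex_text r @ [Bar] @ regex_text s @ [RBrack]"
| "regex_text (Plus r) = [LBrack] @ regex_text r @ [RBrack, PlusSign]"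
| "regex_text (Star r) = [LBrack] @ regex_text r @ [RBrack, StarSign]"

definition regex_length :: "letter regex \<Rightarrow> nat" where
  "regex_length r = length (regex_text r)"

text \<open>The indices of \<open>indices t\<close> in lexicographic order.\<close>

fun index_list :: "nat \<Rightarrow> nat list list" where
  "index_list 0 = [[]]"
| "index_list (Suc n) = map ((#) 0) (index_list n) @ map ((#) 1) (index_list n)"

definition tensor_text :: "nat \<Rightarrow> (nat list \<Rightarrow> nat) \<Rightarrow> token list" where
  "tensor_text t x = map (\<lambda>i. Letter (if x i = 0 then L0 else L1)) (index_list t)"

definition items_text :: "token list list \<Rightarrow> token list" where
  "items_text ws = concat (map (\<lambda>w. w @ [ItemEnd]) ws)"

definition input_text ::
  "nat \<Rightarrow> (nat list \<Rightarrow> nat) list \<Rightarrow> (nat list \<Rightarrow> nat) list \<Rightarrow> token list" where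
  "input_text t as bs =
     items_text (map (tensor_text t) as) @ [ListEnd] @ items_text (map (tensor_text t) bs)"

definition output_text :: "letter regex list \<Rightarrow> letter list list \<Rightarrow> token list" where
  "output_text rs ws =
     items_text (map regex_text rs) @ [ListEnd] @ items_text (map (map Letter) ws)"

text \<open>States are \<open>0, \<dots>, state_count\<close>, where \<open>0\<close> is initial and \<open>state_count\<close> is the halting
  state. Tape symbols are the numbers below \<open>symbol_count\<close>, with \<open>0\<close> as the blank. Tapes are
  infinite in both directions. Tape \<open>0\<close> carries the input, tape \<open>1\<close> the output.\<close>

datatype move = MoveLeft | NoMove | MoveRight

record turing_machine =
  tape_count :: nat
  state_count :: nat
  symbol_count :: nat
  trans :: "nat \<Rightarrow> nat list \<Rightarrow> nat \<times> (nat \<times> move) list"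

type_synonym tape = "(int \<Rightarrow> nat) \<times> int"

type_synonym config = "nat \<times> tape list"

fun token_code :: "token \<Rightarrow> nat" where
  "token_code (Letter L0) = 1"
| "token_code (Letter L1) = 2"
| "token_code (Letter LBot) = 3"
| "token_code LBrack = 4"
| "token_code Bar = 5"
| "token_code RBrack = 6"
| "token_code PlusSign = 7"
| "token_code StarSign = 8"
| "token_code ItemEnd = 9"
| "token_code ListEnd = 10"

definition wf_machine :: "turing_machine \<Rightarrow> bool" where
  "wf_machine M \<longleftrightarrow>
     2 \<le> tape_count M \<and> range token_code \<subseteq> {0 <..< symbol_count M} \<and>
     (\<forall>q rs. q < state_count M \<and> length rs = tape_count M \<and> set rs \<subseteq> {..< symbol_count M} \<longrightarrow>
        (case trans M q rs of (q', acts) \<Rightarrow>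
           q' \<le> state_count M \<and> length acts = tape_count M \<and>
           fst ` set acts \<subseteq> {..< symbol_count M}))"

fun shift :: "move \<Rightarrow> int" where
  "shift MoveLeft = -1"
| "shift NoMove = 0"
| "shift MoveRight = 1"

fun act :: "nat \<times> move \<Rightarrow> tape \<Rightarrow> tape" where
  "act (w, d) (f, h) = (f(h := w), h + shift d)"

fun step :: "turing_machine \<Rightarrow> config \<Rightarrow> config" where
  "step M (q, ts) =
     (if q < state_count M
      then (case trans M q (map (\<lambda>(f, h). f h) ts) of (q', acts) \<Rightarrow> (q', map2 act acts ts))
      else (q, ts))"

definition cells :: "token list \<Rightarrow> int \<Rightarrow> nat" where
  "cells w j = (if 0 \<le> j \<and> j < int (length w) then token_code (w ! nat j) else 0)"

definition init_config :: "turing_machine \<Rightarrow> token list \<Rightarrow> config" where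
  "init_config M w = (0, (cells w, 0) # replicate (tape_count M - 1) (cells [], 0))"

definition computes_within :: "turing_machine \<Rightarrow> token list \<Rightarrow> token list \<Rightarrow> nat \<Rightarrow> bool" where
  "computes_within M inp out T \<longleftrightarrow>
     (\<exists>n \<le> T. \<exists>ts. (step M ^^ n) (init_config M inp) = (state_count M, ts) \<and>
        fst (ts ! 1) = cells out)"

end

theory Submission
  imports Defs
begin

text \<open>The string of \<open>b\<close> is \<open>b\<close> itself, read in lexicographic order. The expression of \<open>a\<close> mirrors
  the similarity: a leaf is \<open>1\<close> or \<open>\<bottom>\<close>, an average becomes a concatenation, and a maximum over the
  expressions \<open>R\<close>, \<open>S\<close> becomes \<open>[RR|SS]\<close>. The repetition keeps all words at length \<open>2\<^sup>t\<close>, and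
  because \<open>b\<close> is max-invariant both copies face the same half of the string, so the best
  Hamming similarity is exactly the maximum. Two levels multiply the length of the expression
  by about 8 while dividing the number of entries by 4, so its length is about \<open>2\<^sup>t\<close> to the
  power \<open>3/2\<close>. A machine with two work tapes builds the expression bottom-up, replacing in each of
  the \<open>t/2\<close> passes every four consecutive expressions by one.\<close>

section \<open>Programs on zippers\<close>

text \<open>The tokens left of the head (nearest first), the token under the head, and the tokens right
  of the head. Everything beyond them is blank, so the only blank that can lie between two tokens is
  the one under the head.\<close>

type_synonym zipper = "token list \<times> token option \<times> token list"

abbreviation blank :: zipper where
  "blank \<equiv> ([], None, [])"

fun on_right :: "token list \<Rightarrow> token list \<Rightarrow> zipper" where
  "on_right l [] = (l, None, [])"
| "on_right l (x # r) = (l, Some x, r)"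

fun on_left :: "token list \<Rightarrow> token list \<Rightarrow> zipper" where
  "on_left [] r = ([], None, r)"
| "on_left (x # l) r = (l, Some x, r)"

definition head :: "zipper \<Rightarrow> token option" where
  "head z = fst (snd z)"

fun push :: "'a option \<Rightarrow> 'a list \<Rightarrow> 'a list" where
  "push None xs = xs"
| "push (Some x) xs = x # xs"

fun zact :: "token option \<times> move \<Rightarrow> zipper \<Rightarrow> zipper" where
  "zact (w, MoveLeft) (l, c, r) = on_left l (push w r)"
| "zact (w, NoMove) (l, c, r) = (l, w, r)"
| "zact (w, MoveRight) (l, c, r) = on_right (push w l) r"

fun leaves_no_gap :: "token option \<times> move \<Rightarrow> zipper \<Rightarrow> bool" where
  "leaves_no_gap (None, MoveLeft) (l, c, r) \<longleftrightarrow> r = []"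
| "leaves_no_gap (None, MoveRight) (l, c, r) \<longleftrightarrow> l = []"
| "leaves_no_gap _ _ \<longleftrightarrow> True"

lemma head_simps [simp]: "head (l, c, r) = c"
  by (simp add: head_def)

lemma head_on_right_eq_None [simp]: "head (on_right l r) = None \<longleftrightarrow> r = []"
  by (cases r) auto

lemma zact_head_NoMove [simp]: "zact (head z, NoMove) z = z"
  by (cases z) simp

lemma leaves_no_gap_NoMove [simp]: "leaves_no_gap (w, NoMove) z"
  by (cases w; cases z) auto

record 'q program =
  tapes :: nat
  start :: 'q
  halt :: 'q
  instr :: "'q \<Rightarrow> token option list \<Rightarrow> 'q \<times> (token option \<times> move) list"

definition wf_program :: "'q program \<Rightarrow> bool" where
  "wf_program P \<longleftrightarrow> 2 \<le> tapes P \<and> start P \<noteq> halt P \<and>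
     (\<forall>p rs p' acts. p \<noteq> halt P \<and> length rs = tapes P \<and> instr P p rs = (p', acts) \<longrightarrow>
        length acts = tapes P \<and>
        (acts ! 1 = (rs ! 1, NoMove) \<or> (\<exists>c. acts ! 1 = (Some c, MoveRight))))"

lemma wf_programD:
  assumes "wf_program P"
  shows "2 \<le> tapes P" "start P \<noteq> halt P"
    and "\<lbrakk>p \<noteq> halt P; length rs = tapes P; instr P p rs = (p', acts)\<rbrakk> \<Longrightarrow>
      length acts = tapes P \<and>
      (acts ! 1 = (rs ! 1, NoMove) \<or> (\<exists>c. acts ! 1 = (Some c, MoveRight)))"
  using assms unfolding wf_program_def by blast+

fun moves :: "'q program \<Rightarrow> 'q \<times> zipper list \<Rightarrow> 'q \<times> zipper list \<Rightarrow> bool" where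
  "moves P (p, zs) c \<longleftrightarrow> p \<noteq> halt P \<and>
     (case instr P p (map head zs) of (p', acts) \<Rightarrow>
        list_all2 leaves_no_gap acts zs \<and> c = (p', map2 zact acts zs))"

inductive reaches :: "'q program \<Rightarrow> nat \<Rightarrow> 'q \<times> zipper list \<Rightarrow> 'q \<times> zipper list \<Rightarrow> bool"
  for P where
  reaches_refl: "reaches P T c c"
| reaches_step: "moves P c c' \<Longrightarrow> reaches P T c' c'' \<Longrightarrow> reaches P (Suc T) c c''"

definition program_computes :: "'q program \<Rightarrow> token list \<Rightarrow> token list \<Rightarrow> nat \<Rightarrow> bool" where
  "program_computes P inp out T \<longleftrightarrow>
     (\<exists>zs. reaches P T (start P, on_right [] inp # replicate (tapes P - 1) blank) (halt P, zs) \<and>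
        zs ! 1 = on_right (rev out) [])"

lemma reaches_move: "moves P c c' \<Longrightarrow> reaches P 1 c c'"
  using reaches_step[OF _ reaches_refl, of P c c' 0] by simp

lemma reaches_mono: "reaches P T c c' \<Longrightarrow> T \<le> T' \<Longrightarrow> reaches P T' c c'"
proof (induction arbitrary: T' rule: reaches.induct)
  case (reaches_step c c' T c'')
  then show ?case
    by (cases T') (auto intro: reaches.reaches_step)
qed (rule reaches_refl)

lemma reaches_trans [trans]:
  "reaches P T c c' \<Longrightarrow> reaches P T' c' c'' \<Longrightarrow> reaches P (T + T') c c''"
proof (induction rule: reaches.induct)
  case (reaches_refl T c)
  then show ?case
    by (rule reaches_mono) simp
qed (auto intro: reaches.reaches_step)

text \<open>A loop: \<open>c u v\<close> is the configuration in which \<open>u\<close> is still to be consumed and \<open>v\<close> is the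
  reversed result so far.\<close>

lemma reaches_concat:
  assumes "\<And>x u v. x \<in> set xs \<Longrightarrow> reaches P T (c (x # u) v) (c u (rev (f x) @ v))"
  shows "reaches P (length xs * T) (c xs v) (c [] (rev (concat (map f xs)) @ v))"
  using assms
proof (induction xs arbitrary: v)
  case (Cons x xs)
  have "reaches P T (c (x # xs) v) (c xs (rev (f x) @ v))"
    using Cons.prems by simp
  also have "reaches P (length xs * T) \<dots> (c [] (rev (concat (map f xs)) @ rev (f x) @ v))"
    using Cons by simp
  finally show ?case
    by simp
qed (simp add: reaches_refl)

lemma reaches_transfer:
  assumes "\<And>x u v. x \<in> set xs \<Longrightarrow> moves P (c (x # u) v) (c u (x # v))"
  shows "reaches P (length xs) (c xs v) (c [] (rev xs @ v))"
  using reaches_concat[where P = P and T = 1 and c = c and xs = xs and v = v and f = "\<lambda>x. [x]"]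
    reaches_move[OF assms]
  by simp

section \<open>Compiling programs to Turing machines\<close>

fun symbol_code :: "token option \<Rightarrow> nat" where
  "symbol_code None = 0"
| "symbol_code (Some c) = token_code c"

definition compile :: "('q \<Rightarrow> nat) \<Rightarrow> 'q program \<Rightarrow> turing_machine" where
  "compile code P =
     \<lparr>tape_count = tapes P, state_count = code (halt P), symbol_count = 11,
      trans = \<lambda>q rs. map_prod code (map (apfst symbol_code))
        (instr P (inv code q) (map (inv symbol_code) rs))\<rparr>"

definition numbering :: "('q \<Rightarrow> nat) \<Rightarrow> 'q program \<Rightarrow> bool" where
  "numbering code P \<longleftrightarrow> inj code \<and> range code = {..code (halt P)} \<and> code (start P) = 0"

fun tape_of :: "int \<Rightarrow> zipper \<Rightarrow> tape" where
  "tape_of h (l, c, r) =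
     (\<lambda>j. if j < h then cells l (h - 1 - j) else if j = h then symbol_code c
          else cells r (j - h - 1), h)"

text \<open>Head positions are arbitrary except on the output tape, whose text has to start in cell 0.\<close>

fun represents :: "('q \<Rightarrow> nat) \<Rightarrow> 'q program \<Rightarrow> 'q \<times> zipper list \<Rightarrow> config \<Rightarrow> bool" where
  "represents code P (p, zs) C \<longleftrightarrow> length zs = tapes P \<and>
     (\<exists>hs. length hs = tapes P \<and> hs ! 1 = int (length (fst (zs ! 1))) \<and>
        C = (code p, map2 tape_of hs zs))"

lemma compile_simps [simp]:
  "tape_count (compile code P) = tapes P" "state_count (compile code P) = code (halt P)"
  "symbol_count (compile code P) = 11"
  "trans (compile code P) q rs = map_prod code (map (apfst symbol_code))
    (instr P (inv code q) (map (inv symbol_code) rs))"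
  by (simp_all add: compile_def)

lemma token_code_neq_0 [simp]: "token_code c \<noteq> 0"
  by (cases c rule: token_code.cases) simp_all

lemma symbol_code_less: "symbol_code s < 11"
proof (cases s)
  case (Some c)
  then show ?thesis
    by (cases c rule: token_code.cases) simp_all
qed simp

lemma inj_symbol_code: "inj symbol_code"
proof (rule injI)
  fix s s' assume "symbol_code s = symbol_code s'"
  moreover have "c = d" if "token_code c = token_code d" for c d
    using that by (cases c rule: token_code.cases; cases d rule: token_code.cases) simp_all
  ultimately show "s = s'"
    by (cases s; cases s') simp_all
qed

lemma ex_numbering:
  fixes P :: "'q::finite program"
  assumes "start P \<noteq> halt P"
  obtains code where "numbering code P"
proof -
  define R where "R = UNIV - {start P, halt P}"
  obtain f where f: "f ` R = {1..card R}"
    using finite_same_card_bij[of R "{1..card R}"] by (auto simp: bij_betw_def)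
  define code where "code = f(start P := 0, halt P := Suc (card R))"
  have "range code = code ` {start P, halt P} \<union> code ` R"
    unfolding R_def by blast
  also have "code ` R = f ` R"
    by (rule image_cong) (auto simp: code_def R_def)
  finally have range: "range code = {..Suc (card R)}"
    using assms f by (auto simp: code_def)
  have "card (UNIV :: 'q set) = Suc (Suc (card R))"
    using assms card_Diff_subset[of "{start P, halt P}" UNIV] card_mono[of UNIV "{start P, halt P}"]
    by (simp add: R_def)
  then have "inj code"
    by (intro eq_card_imp_inj_on) (simp_all add: range)
  moreover note range
  moreover have "code (start P) = 0" "code (halt P) = Suc (card R)"
    using assms by (simp_all add: code_def)
  ultimately show ?thesis
    using that unfolding numbering_def by metis
qed

lemma numbering_le: "numbering code P \<Longrightarrow> code p \<le> code (halt P)"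
  unfolding numbering_def by blast

lemma numbering_less:
  assumes "numbering code P" "p \<noteq> halt P"
  shows "code p < code (halt P)"
  using numbering_le[OF assms(1)] assms by (auto simp: numbering_def le_less dest: injD)

lemma wf_machine_compile:
  assumes "wf_program P" "numbering code P"
  shows "wf_machine (compile code P)"
  unfolding wf_machine_def compile_simps
proof (intro conjI allI impI)
  show "2 \<le> tapes P"
    using assms(1) by (rule wf_programD)
  show "range token_code \<subseteq> {0<..<11}"
  proof (rule image_subsetI)
    fix c show "token_code c \<in> {0<..<11}"
      using symbol_code_less[of "Some c"] by (auto intro: gr0I)
  qed
next
  fix q :: nat and rs :: "nat list"
  assume "q < code (halt P) \<and> length rs = tapes P \<and> set rs \<subseteq> {..<11}"
  then have q: "q < code (halt P)" and rs: "length rs = tapes P"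
    by simp_all
  obtain p acts where instr: "instr P (inv code q) (map (inv symbol_code) rs) = (p, acts)"
    by (cases "instr P (inv code q) (map (inv symbol_code) rs)")
  have "q \<in> range code"
    using assms(2) q by (simp add: numbering_def)
  then have "code (inv code q) = q"
    by (rule f_inv_into_f)
  then have "inv code q \<noteq> halt P"
    using q by auto
  then have "length acts = tapes P"
    using wf_programD(3)[OF assms(1) _ _ instr] rs by simp
  then show "case map_prod code (map (apfst symbol_code))
        (instr P (inv code q) (map (inv symbol_code) rs)) of (q', acts) \<Rightarrow>
      q' \<le> code (halt P) \<and> length acts = tapes P \<and> fst ` set acts \<subseteq> {..<11}"
    using symbol_code_less numbering_le[OF assms(2)] by (auto simp: instr)
qed

lemma cells_Nil [simp]: "cells [] j = 0"
  by (simp add: cells_def)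

lemma cells_Cons: "cells (x # w) j = (if j = 0 then token_code x else cells w (j - 1))"
  by (auto simp: cells_def nth_Cons' nat_diff_distrib')

lemma cells_negative: "j < 0 \<Longrightarrow> cells w j = 0"
  by (simp add: cells_def)

lemma tape_of_on_right:
  "tape_of h (on_right l r) = (\<lambda>j. if j < h then cells l (h - 1 - j) else cells r (j - h), h)"
  by (cases r) (auto simp: cells_Cons fun_eq_iff)

lemma tape_of_on_left:
  "tape_of h (on_left l r) = (\<lambda>j. if j \<le> h then cells l (h - j) else cells r (j - h - 1), h)"
  by (cases l) (auto simp: cells_Cons fun_eq_iff algebra_simps)

lemma cells_push:
  "w = None \<longrightarrow> xs = [] \<Longrightarrow>
     cells (push w xs) j = (if j = 0 then symbol_code w else cells xs (j - 1))"
  by (cases w) (auto simp: cells_Cons)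

lemma act_tape_of:
  assumes "leaves_no_gap (w, d) z"
  shows "act (symbol_code w, d) (tape_of h z) = tape_of (h + shift d) (zact (w, d) z)"
proof (cases z)
  case (fields l c r)
  show ?thesis
  proof (cases d)
    case MoveLeft
    then have "w = None \<longrightarrow> r = []"
      using assms by (auto simp: fields)
    then show ?thesis
      by (auto simp: fields MoveLeft tape_of_on_left cells_push fun_eq_iff algebra_simps)
  next
    case MoveRight
    then have "w = None \<longrightarrow> l = []"
      using assms by (auto simp: fields)
    then show ?thesis
      by (auto simp: fields MoveRight tape_of_on_right cells_push fun_eq_iff algebra_simps)
  qed (auto simp: fields)
qed

lemma tape_of_read: "(case tape_of h z of (f, j) \<Rightarrow> f j) = symbol_code (head z)"
  by (cases z) simp

definition displace :: "(token option \<times> move) list \<Rightarrow> int list \<Rightarrow> int list" where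
  "displace acts hs = map2 (\<lambda>(w, d) h. h + shift d) acts hs"

lemma map2_act_tape_of:
  assumes "list_all2 leaves_no_gap acts zs" "length hs = length zs"
  shows "map2 act (map (apfst symbol_code) acts) (map2 tape_of hs zs) =
    map2 tape_of (displace acts hs) (map2 zact acts zs)"
proof (rule nth_equalityI)
  fix i assume "i < length (map2 act (map (apfst symbol_code) acts) (map2 tape_of hs zs))"
  then have i: "i < length zs" "i < length acts"
    using assms by (auto simp: list_all2_lengthD)
  obtain w d where wd: "acts ! i = (w, d)"
    by (cases "acts ! i")
  then have "leaves_no_gap (w, d) (zs ! i)"
    using assms(1) i by (metis list_all2_nthD)
  then show "map2 act (map (apfst symbol_code) acts) (map2 tape_of hs zs) ! i =
      map2 tape_of (displace acts hs) (map2 zact acts zs) ! i"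
    using assms(2) i wd by (simp add: displace_def act_tape_of)
qed (use assms in \<open>simp add: displace_def\<close>)

lemma represents_moves:
  assumes "wf_program P" "numbering code P" "represents code P c C" "moves P c c'"
  shows "represents code P c' (step (compile code P) C)"
proof -
  obtain p zs where c: "c = (p, zs)"
    by (cases c)
  obtain hs where zs: "length zs = tapes P" and hs: "length hs = tapes P"
    and out: "hs ! 1 = int (length (fst (zs ! 1)))" and C: "C = (code p, map2 tape_of hs zs)"
    using assms(3) by (auto simp: c)
  obtain p' acts where instr: "instr P p (map head zs) = (p', acts)"
    by (cases "instr P p (map head zs)")
  have p: "p \<noteq> halt P" and gap: "list_all2 leaves_no_gap acts zs"
    and c': "c' = (p', map2 zact acts zs)"
    using assms(4) by (auto simp: c instr)
  have tapes: "2 \<le> tapes P" and acts: "length acts = tapes P"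
    and append: "acts ! 1 = (head (zs ! 1), NoMove) \<or> (\<exists>d. acts ! 1 = (Some d, MoveRight))"
    using wf_programD(1)[OF assms(1)] wf_programD(3)[OF assms(1) p _ instr] zs by auto
  have "map (inv symbol_code) (map (\<lambda>(f, j). f j) (map2 tape_of hs zs)) = map head zs"
    using hs zs
    by (intro nth_equalityI) (auto simp: tape_of_read inv_f_f[OF inj_symbol_code])
  moreover have "inv code (code p) = p"
    using assms(2) by (simp add: numbering_def)
  ultimately have "step (compile code P) C =
      (code p', map2 act (map (apfst symbol_code) acts) (map2 tape_of hs zs))"
    using numbering_less[OF assms(2) p] instr by (simp add: C del: map_map)
  then have step: "step (compile code P) C =
      (code p', map2 tape_of (displace acts hs) (map2 zact acts zs))"
    using gap hs zs by (simp add: map2_act_tape_of)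
  obtain l s r where "zs ! 1 = (l, s, r)"
    by (cases "zs ! 1")
  then have "displace acts hs ! 1 = int (length (fst (map2 zact acts zs ! 1)))"
    using append out tapes acts hs zs by (cases r) (auto simp: displace_def)
  moreover have "length (displace acts hs) = tapes P"
    using acts hs by (simp add: displace_def)
  ultimately show ?thesis
    using acts zs by (auto simp: c' step)
qed

lemma represents_reaches:
  assumes "reaches P T c c'" "wf_program P" "numbering code P" "represents code P c C"
  shows "\<exists>n \<le> T. represents code P c' ((step (compile code P) ^^ n) C)"
  using assms
proof (induction arbitrary: C rule: reaches.induct)
  case (reaches_refl T c)
  then show ?case
    by (metis funpow_0 le0)
next
  case (reaches_step c c' T c'')
  then obtain n where "n \<le> T"
    "represents code P c'' ((step (compile code P) ^^ n) (step (compile code P) C))"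
    using represents_moves by blast
  then show ?case
    by (intro exI[of _ "Suc n"]) (simp add: funpow_swap1)
qed

lemma represents_init:
  assumes "numbering code P" "wf_program P"
  shows "represents code P (start P, on_right [] inp # replicate (tapes P - 1) blank)
    (init_config (compile code P) inp)"
proof -
  obtain m where m: "tapes P = Suc (Suc m)"
    using wf_programD(1)[OF assms(2)] by (metis Suc_le_D Suc_le_mono numeral_2_eq_2)
  have "(cells inp, 0) = tape_of 0 (on_right [] inp)" "(cells [], 0) = tape_of 0 blank"
    by (auto simp: tape_of_on_right cells_negative)
  then have "init_config (compile code P) inp = (code (start P),
      map2 tape_of (replicate (tapes P) 0) (on_right [] inp # replicate (tapes P - 1) blank))"
    using assms(1) by (simp add: init_config_def numbering_def m zip_replicate del: tape_of.simps)
  then show ?thesis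
    by (auto simp: m intro!: exI[of _ "replicate (tapes P) 0"])
qed

lemma cells_rev: "cells (rev w) (int (length w) - 1 - j) = cells w j"
proof (cases "0 \<le> j \<and> j < int (length w)")
  case True
  then have "nat (int (length w) - 1 - j) = length w - Suc (nat j)" "nat j < length w"
    by auto
  with True show ?thesis
    by (simp add: cells_def rev_nth)
qed (auto simp: cells_def)

lemma fst_tape_of_output: "fst (tape_of (int (length w)) (rev w, None, [])) = cells w"
  by (auto simp: cells_rev fun_eq_iff cells_def[of w])

lemma computes_within_compile:
  assumes "wf_program P" "numbering code P" "program_computes P inp out T"
  shows "computes_within (compile code P) inp out T"
proof -
  obtain zs where "zs ! 1 = on_right (rev out) []"
    and "reaches P T (start P, on_right [] inp # replicate (tapes P - 1) blank) (halt P, zs)"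
    using assms(3) by (auto simp: program_computes_def)
  moreover from this(2) obtain n where "n \<le> T"
    "represents code P (halt P, zs)
      ((step (compile code P) ^^ n) (init_config (compile code P) inp))"
    using represents_reaches[OF _ assms(1,2) represents_init[OF assms(2,1)]] by blast
  moreover have "2 \<le> tapes P"
    using assms(1) by (rule wf_programD)
  ultimately show ?thesis
    unfolding computes_within_def
    by (intro exI[of _ n]) (auto simp: fst_tape_of_output simp del: tape_of.simps)
qed

lemma program_computable:
  fixes P :: "'q::finite program"
  assumes "wf_program P"
  shows "\<exists>M. wf_machine M \<and>
    (\<forall>inp out T. program_computes P inp out T \<longrightarrow> computes_within M inp out T)"
proof -
  obtain code where "numbering code P"
    using assms ex_numbering wf_programD(2) by blast
  then show ?thesis
    using assms wf_machine_compile computes_within_compile by blast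
qed

section \<open>Tensors as words and as expressions\<close>

definition tensor_word :: "nat \<Rightarrow> (nat list \<Rightarrow> nat) \<Rightarrow> letter list" where
  "tensor_word t b = map (\<lambda>i. if b i = 0 then L0 else L1) (index_list t)"

definition alt_twice :: "'a regex \<Rightarrow> 'a regex \<Rightarrow> 'a regex" where
  "alt_twice r s = Alt (Cat r r) (Cat s s)"

definition two_levels :: "(nat \<Rightarrow> nat \<Rightarrow> 'a regex) \<Rightarrow> 'a regex" where
  "two_levels f = Cat (alt_twice (f 0 0) (f 0 1)) (alt_twice (f 1 0) (f 1 1))"

fun tensor_regex :: "nat \<Rightarrow> (nat list \<Rightarrow> nat) \<Rightarrow> letter regex" where
  "tensor_regex 0 a = Sym (if a [] = 0 then LBot else L1)"
| "tensor_regex (Suc k) a = two_levels (\<lambda>c d. tensor_regex k (\<lambda>l. a (c # d # l)))"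

lemma Nil_in_indices [simp]: "[] \<in> indices 0"
  by (simp add: indices_def)

lemma Cons_in_indices [simp]: "c # l \<in> indices (Suc n) \<longleftrightarrow> c \<in> {0, 1} \<and> l \<in> indices n"
  by (auto simp: indices_def)

lemma indices_SucE:
  assumes "i \<in> indices (Suc n)"
  obtains c l where "i = c # l" "c \<in> {0, 1}" "l \<in> indices n"
  using assms by (cases i) (auto simp: indices_def)

lemma length_index_list [simp]: "length (index_list t) = 2 ^ t"
  by (induction t) auto

lemma set_index_list: "set (index_list t) = indices t"
proof (induction t)
  case (Suc t)
  then show ?case
    by (auto elim: indices_SucE)
qed (auto simp: indices_def)

lemma index_list_Suc_Suc:
  "index_list (Suc (Suc n)) =
    concat (map (\<lambda>i. [i @ [0, 0], i @ [0, 1], i @ [1, 0], i @ [1, 1]]) (index_list n))"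
proof (induction n)
  case (Suc n)
  have "index_list (Suc (Suc (Suc n))) =
      map ((#) 0) (index_list (Suc (Suc n))) @ map ((#) 1) (index_list (Suc (Suc n)))"
    by (rule index_list.simps)
  also have "\<dots> = concat (map (\<lambda>i. [i @ [0, 0], i @ [0, 1], i @ [1, 0], i @ [1, 1]])
      (index_list (Suc n)))"
    unfolding Suc by (simp add: map_concat o_def)
  finally show ?case .
qed simp

lemma tensors_eqI:
  assumes "a \<in> tensors t" "a' \<in> tensors t" "\<And>i. i \<in> indices t \<Longrightarrow> a i = 0 \<longleftrightarrow> a' i = 0"
  shows "a = a'"
proof (rule PiE_ext)
  show "a \<in> indices t \<rightarrow>\<^sub>E {0, 1}" "a' \<in> indices t \<rightarrow>\<^sub>E {0, 1}"
    using assms by (simp_all add: tensors_def)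
next
  fix i assume i: "i \<in> indices t"
  then have "a i \<in> {0, 1}" "a' i \<in> {0, 1}"
    using assms(1,2) by (auto simp: tensors_def)
  then show "a i = a' i"
    using assms(3)[OF i] by auto
qed

lemma length_tensor_word [simp]: "length (tensor_word t b) = 2 ^ t"
  by (simp add: tensor_word_def)

lemma tensor_text_word: "tensor_text t b = map Letter (tensor_word t b)"
  by (simp add: tensor_text_def tensor_word_def)

lemma tensor_word_Suc:
  "tensor_word (Suc n) b = tensor_word n (\<lambda>l. b (0 # l)) @ tensor_word n (\<lambda>l. b (1 # l))"
  by (simp add: tensor_word_def o_def)

lemma inj_tensor_word: "inj_on (tensor_word t) (tensors t)"
proof (rule inj_onI)
  fix b b' assume "b \<in> tensors t" "b' \<in> tensors t" "tensor_word t b = tensor_word t b'"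
  then show "b = b'"
    by (intro tensors_eqI) (auto simp: tensor_word_def set_index_list split: if_splits)
qed

lemma regex_length_tensor_regex: "7 * regex_length (tensor_regex k a) + 6 = 13 * 8 ^ k"
proof (induction k arbitrary: a)
  case (Suc k)
  show ?case
    using Suc[of "\<lambda>l. a (0 # 0 # l)"] Suc[of "\<lambda>l. a (0 # 1 # l)"]
      Suc[of "\<lambda>l. a (1 # 0 # l)"] Suc[of "\<lambda>l. a (1 # 1 # l)"]
    by (simp add: regex_length_def two_levels_def alt_twice_def)
qed (simp add: regex_length_def)

lemma regex_length_tensor_regex_less: "regex_length (tensor_regex k a) < 2 * 8 ^ k"
  using regex_length_tensor_regex[of k a] one_le_power[of "8 :: nat" k] by linarith

lemma square_two_power_double: "(2 ^ (2 * k)) ^ 2 = (16 :: nat) ^ k"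
  by (simp add: power_mult power2_eq_square flip: power_mult_distrib)

lemma regex_length_tensor_regex_le: "regex_length (tensor_regex k a) \<le> 2 * (2 ^ (2 * k)) ^ 2"
  using regex_length_tensor_regex_less[of k a] power_mono[of "8 :: nat" 16 k]
  unfolding square_two_power_double by linarith

lemma tensor_regex_text_eqD:
  assumes "regex_text (tensor_regex k a) = regex_text (tensor_regex k a')" "i \<in> indices (2 * k)"
  shows "a i = 0 \<longleftrightarrow> a' i = 0"
  using assms
proof (induction k arbitrary: a a' i)
  case 0
  then show ?case
    by (auto simp: indices_def split: if_splits)
next
  case (Suc k)
  obtain c d l where i: "i = c # d # l" "c \<in> {0, 1}" "d \<in> {0, 1}" "l \<in> indices (2 * k)"
    using Suc.prems(2) by (auto elim!: indices_SucE)
  have "length (regex_text (tensor_regex k x)) = length (regex_text (tensor_regex k y))" for x y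
    using regex_length_tensor_regex[of k x] regex_length_tensor_regex[of k y]
    by (simp add: regex_length_def)
  then have "regex_text (tensor_regex k (\<lambda>l. a (c # d # l))) =
      regex_text (tensor_regex k (\<lambda>l. a' (c # d # l)))"
    using Suc.prems(1) i(2,3) by (auto simp: two_levels_def alt_twice_def)
  then show ?case
    unfolding i(1) using i(4) by (rule Suc.IH)
qed

lemma inj_tensor_regex_text: "inj_on (\<lambda>a. regex_text (tensor_regex k a)) (tensors (2 * k))"
  by (rule inj_onI) (auto intro: tensors_eqI dest: tensor_regex_text_eqD)

section \<open>Similarity\<close>

definition agreement :: "'a list \<Rightarrow> 'a list \<Rightarrow> nat" where
  "agreement x y = length (filter (\<lambda>(c, d). c = d) (zip x y))"

definition best_agreement :: "'a regex \<Rightarrow> 'a list \<Rightarrow> real \<Rightarrow> bool" where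
  "best_agreement r y v \<longleftrightarrow>
     (\<forall>x \<in> lang r. length x = length y \<and> real (agreement x y) \<le> v) \<and>
     (\<exists>x \<in> lang r. real (agreement x y) = v)"

lemma agreement_append [simp]:
  "length x = length y \<Longrightarrow> agreement (x @ x') (y @ y') = agreement x y + agreement x' y'"
  by (simp add: agreement_def)

lemma agreement_le: "agreement x y \<le> length y"
  unfolding agreement_def by (rule order_trans[OF length_filter_le]) simp

lemma HamSim_agreement:
  assumes "length x = length y"
  shows "HamSim x y = real (agreement x y) / real (length y)"
proof -
  have "{j. j < length x \<and> x ! j = y ! j} =
      {j. j < length (zip x y) \<and> (\<lambda>(c, d). c = d) (zip x y ! j)}"
    using assms by auto
  then show ?thesis
    using assms by (simp add: HamSim_def agreement_def length_filter_conv_card)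
qed

lemma best_agreement_Sym: "best_agreement (Sym c) [d] (if c = d then 1 else 0)"
  by (simp add: best_agreement_def agreement_def)

lemma best_agreement_Cat:
  assumes "best_agreement r y v" "best_agreement s y' v'"
  shows "best_agreement (Cat r s) (y @ y') (v + v')"
proof -
  obtain x x' where x: "x \<in> lang r" "real (agreement x y) = v" "length x = length y"
    "x' \<in> lang s" "real (agreement x' y') = v'"
    using assms by (auto simp: best_agreement_def)
  then have "x @ x' \<in> lang (Cat r s) \<and> real (agreement (x @ x') (y @ y')) = v + v'"
    by auto
  moreover have "\<forall>x \<in> lang (Cat r s).
      length x = length (y @ y') \<and> real (agreement x (y @ y')) \<le> v + v'"
    using assms by (fastforce simp: best_agreement_def intro: add_mono)
  ultimately show ?thesis
    unfolding best_agreement_def by blast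
qed

lemma best_agreement_Alt:
  assumes "best_agreement r y v" "best_agreement s y v'"
  shows "best_agreement (Alt r s) y (max v v')"
  using assms unfolding best_agreement_def by (fastforce simp: max_def)

lemma best_agreement_alt_twice:
  assumes "best_agreement r y v" "best_agreement s y v'"
  shows "best_agreement (alt_twice r s) (y @ y) (2 * max v v')"
proof -
  have "best_agreement (alt_twice r s) (y @ y) (max (v + v) (v' + v'))"
    unfolding alt_twice_def using assms by (intro best_agreement_Alt best_agreement_Cat)
  also have "max (v + v) (v' + v') = 2 * max v v'"
    by simp
  finally show ?thesis .
qed

lemma best_agreement_two_levels:
  assumes "\<And>c d. c \<in> {0, 1} \<Longrightarrow> d \<in> {0, 1} \<Longrightarrow> best_agreement (f c d) (y c) (v c d)"
  shows "best_agreement (two_levels f) ((y 0 @ y 0) @ (y 1 @ y 1))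
    (2 * max (v 0 0) (v 0 1) + 2 * max (v 1 0) (v 1 1))"
  unfolding two_levels_def
  using assms by (intro best_agreement_Cat best_agreement_alt_twice) simp_all

lemma best_agreement_nonempty: "best_agreement r y v \<Longrightarrow> \<exists>x \<in> lang r. length x = length y"
  by (auto simp: best_agreement_def)

lemma MaxSim_best_agreement:
  assumes "best_agreement r y v"
  shows "MaxSim r y = v / real (length y)"
proof -
  let ?S = "{HamSim x y | x. x \<in> lang r \<and> length x = length y}"
  have "?S \<subseteq> (\<lambda>n. real n / real (length y)) ` {..length y}"
    by (auto simp: HamSim_agreement agreement_le)
  then have "finite ?S"
    by (rule finite_subset) simp
  moreover have "s \<le> v / real (length y)" if "s \<in> ?S" for s
    using that assms by (auto simp: HamSim_agreement best_agreement_def intro!: divide_right_mono)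
  moreover have "v / real (length y) \<in> ?S"
  proof -
    obtain x where "x \<in> lang r" "real (agreement x y) = v" "length x = length y"
      using assms by (auto simp: best_agreement_def)
    then show ?thesis
      by (intro CollectI exI[of _ x]) (simp add: HamSim_agreement)
  qed
  ultimately show ?thesis
    unfolding MaxSim_def by (intro Max_eqI) auto
qed

lemma nth_Cons_Cons_cong:
  assumes "\<And>k. k < n \<Longrightarrow> even k \<Longrightarrow> i ! k = j ! k" "even k" "k < Suc (Suc n)"
  shows "(c # d # i) ! k = (c # d' # j) ! k"
proof (cases k)
  case (Suc m)
  with assms obtain k' where "k = Suc (Suc k')"
    by (cases m) auto
  with assms show ?thesis
    by simp
qed simp

lemma max_invariant_Suc_SucD:
  assumes "max_invariant (Suc (Suc n)) b" "c \<in> {0, 1}" "d \<in> {0, 1}" "d' \<in> {0, 1}"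
    and "i \<in> indices n" "j \<in> indices n" "\<And>k. k < n \<Longrightarrow> even k \<Longrightarrow> i ! k = j ! k"
  shows "b (c # d # i) = b (c # d' # j)"
  using assms(1) unfolding max_invariant_def
proof (elim ballE impE)
  show "\<forall>k < Suc (Suc n). even k \<longrightarrow> (c # d # i) ! k = (c # d' # j) ! k"
    using nth_Cons_Cons_cong[OF assms(7)] by blast
qed (use assms(2-6) in auto)

lemma max_invariant_slice:
  assumes "max_invariant (Suc (Suc n)) b" "c \<in> {0, 1}" "d \<in> {0, 1}"
  shows "max_invariant n (\<lambda>l. b (c # d # l))"
  unfolding max_invariant_def using max_invariant_Suc_SucD[OF assms assms(3)] by blast

lemma tensor_word_slice_eq:
  assumes "max_invariant (Suc (Suc n)) b" "c \<in> {0, 1}" "d \<in> {0, 1}" "d' \<in> {0, 1}"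
  shows "tensor_word n (\<lambda>l. b (c # d # l)) = tensor_word n (\<lambda>l. b (c # d' # l))"
  using max_invariant_Suc_SucD[OF assms] by (auto simp: tensor_word_def set_index_list)

lemma best_agreement_tensor_regex:
  assumes "max_invariant (2 * k) b"
    and "\<And>i. i \<in> indices (2 * k) \<Longrightarrow> a i \<in> {0, 1} \<and> b i \<in> {0, 1}"
  shows "best_agreement (tensor_regex k a) (tensor_word (2 * k) b)
    (4 ^ k * avg_level (2 * k) (\<lambda>i. real (a i * b i)))"
  using assms
proof (induction k arbitrary: a b)
  case 0
  then have "a [] \<in> {0, 1} \<and> b [] \<in> {0, 1}"
    by simp
  then show ?case
    using best_agreement_Sym[of "if a [] = 0 then LBot else L1" "if b [] = 0 then L0 else L1"]
    by (auto simp: tensor_word_def)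
next
  case (Suc k)
  define y where "y c = tensor_word (2 * k) (\<lambda>l. b (c # 0 # l))" for c
  define v where "v c d = avg_level (2 * k) (\<lambda>l. real (a (c # d # l) * b (c # d # l)))" for c d
  have inv: "max_invariant (Suc (Suc (2 * k))) b"
    using Suc.prems(1) by simp
  have y: "tensor_word (2 * k) (\<lambda>l. b (c # d # l)) = y c" if "c \<in> {0, 1}" "d \<in> {0, 1}" for c d
    unfolding y_def using that by (intro tensor_word_slice_eq[OF inv]) auto
  have "best_agreement (tensor_regex k (\<lambda>l. a (c # d # l))) (y c) (4 ^ k * v c d)"
    if "c \<in> {0, 1}" "d \<in> {0, 1}" for c d
    unfolding v_def y[OF that, symmetric] using Suc.prems(2) that
    by (intro Suc.IH max_invariant_slice[OF inv]) auto
  then have "best_agreement (tensor_regex (Suc k) a) ((y 0 @ y 0) @ (y 1 @ y 1))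
      (2 * max (4 ^ k * v 0 0) (4 ^ k * v 0 1) + 2 * max (4 ^ k * v 1 0) (4 ^ k * v 1 1))"
    unfolding tensor_regex.simps by (rule best_agreement_two_levels)
  also have "(y 0 @ y 0) @ (y 1 @ y 1) = tensor_word (2 * Suc k) b"
    using y[of 0 0] y[of 0 1] y[of 1 0] y[of 1 1] by (simp add: tensor_word_Suc)
  also have "2 * max (4 ^ k * v 0 0) (4 ^ k * v 0 1) + 2 * max (4 ^ k * v 1 0) (4 ^ k * v 1 1) =
      4 ^ Suc k * avg_level (2 * Suc k) (\<lambda>i. real (a i * b i))"
  proof -
    have scale: "max (4 ^ k * p) (4 ^ k * q) = 4 ^ k * max p q" for p q :: real
      by (simp add: max_mult_distrib_left)
    show ?thesis
      unfolding scale by (simp add: v_def algebra_simps)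
  qed
  finally show ?case .
qed

lemma MaxSim_tensor_regex:
  assumes "a \<in> tensors (2 * k)" "b \<in> tensors (2 * k)" "max_invariant (2 * k) b"
  shows "\<exists>x \<in> lang (tensor_regex k a). length x = length (tensor_word (2 * k) b)"
    and "MaxSim (tensor_regex k a) (tensor_word (2 * k) b) = trop_sim (2 * k) a b"
proof -
  have best: "best_agreement (tensor_regex k a) (tensor_word (2 * k) b)
      (4 ^ k * avg_level (2 * k) (\<lambda>i. real (a i * b i)))"
    using assms by (intro best_agreement_tensor_regex) (auto simp: tensors_def)
  show "\<exists>x \<in> lang (tensor_regex k a). length x = length (tensor_word (2 * k) b)"
    using best by (rule best_agreement_nonempty)
  show "MaxSim (tensor_regex k a) (tensor_word (2 * k) b) = trop_sim (2 * k) a b"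
    unfolding MaxSim_best_agreement[OF best] by (simp add: trop_sim_def power_mult)
qed

section \<open>The program\<close>

text \<open>Tape 0 is erased while it is read, tape 1 only grows, and tapes 2 and 3 hold lists of items.
  \<open>Load\<close> and \<open>Separate\<close> unpack a tensor onto tape 3 as one-letter expressions. \<open>Turn\<close> and \<open>Unload\<close>
  move this list to tape 2; the flag of \<open>Unload\<close> tells whether it has several items. A single item
  goes to the output by \<open>Emit\<close>. Otherwise a pass replaces every four items \<open>x\<close>, \<open>y\<close>, \<open>z\<close>, \<open>w\<close> by
  \<open>[xx|yy][zz|ww]\<close> on tape 3: each item is copied by \<open>Scan\<close> and, after \<open>Rewind\<close>, copied again by
  \<open>Erase\<close>. The two flags of these phases tell whether the item lies in the second alternation and
  whether it is the second branch of its alternation. \<open>Copy\<close> treats the second input list.\<close>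

datatype phase =
    Load | Separate | Turn | Unload bool | Emit | Copy | Open bool
  | Scan bool bool | Rewind bool bool | Erase bool bool | Close | Halt

instance phase :: finite
proof
  let ?S = "{Load, Separate, Turn, Emit, Copy, Close, Halt} \<union> range Unload \<union> range Open \<union>
    range (case_prod Scan) \<union> range (case_prod Rewind) \<union> range (case_prod Erase)"
  have "p \<in> ?S" for p
    by (cases p) auto
  then have "UNIV \<subseteq> ?S" ..
  then show "finite (UNIV :: phase set)"
    by (rule finite_subset) simp
qed

definition leaf_letter :: "letter \<Rightarrow> letter" where
  "leaf_letter c = (if c = L0 then LBot else c)"

definition after_branch :: "bool \<Rightarrow> bool \<Rightarrow> phase" where
  "after_branch h b = (if b then if h then Close else Open True else Scan h True)"

definition branch_end :: "bool \<Rightarrow> token" where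
  "branch_end b = (if b then RBrack else Bar)"

abbreviation keep :: "token option \<Rightarrow> token option \<times> move" where
  "keep s \<equiv> (s, NoMove)"

fun merge_instr :: "phase \<Rightarrow> token option list \<Rightarrow> phase \<times> (token option \<times> move) list" where
  "merge_instr Load [i, out, u, v] =
    (case i of
       Some (Letter c) \<Rightarrow>
         (Separate, [(None, MoveRight), keep out, keep u,
            (Some (Letter (leaf_letter c)), MoveRight)])
     | Some ItemEnd \<Rightarrow> (Turn, [(None, MoveRight), keep out, keep u, (v, MoveLeft)])
     | _ \<Rightarrow> (Copy, [(None, MoveRight), (Some ListEnd, MoveRight), keep u, keep v]))"
| "merge_instr Separate [i, out, u, v] =
    (Load, [keep i, keep out, keep u, (Some ItemEnd, MoveRight)])"
| "merge_instr Turn [i, out, u, v] =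
    (Unload False, [keep i, keep out, (v, MoveLeft), (None, MoveLeft)])"
| "merge_instr (Unload m) [i, out, u, v] =
    (if v = None then (if m then Open False else Emit, [keep i, keep out, (u, MoveRight), keep v])
     else (Unload (m \<or> v = Some ItemEnd), [keep i, keep out, (v, MoveLeft), (None, MoveLeft)]))"
| "merge_instr Emit [i, out, u, v] =
    (if u = None then (Load, [keep i, keep out, keep u, keep v])
     else (Emit, [keep i, (u, MoveRight), (None, MoveRight), keep v]))"
| "merge_instr Copy [i, out, u, v] =
    (if i = None then (Halt, [keep i, keep out, keep u, keep v])
     else (Copy, [(None, MoveRight), (i, MoveRight), keep u, keep v]))"
| "merge_instr (Open h) [i, out, u, v] =
    (if u = None then (Turn, [keep i, keep out, keep u, (v, MoveLeft)])
     else (Scan h False, [keep i, keep out, keep u, (Some LBrack, MoveRight)]))"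
| "merge_instr (Scan h b) [i, out, u, v] =
    (if u = Some ItemEnd then (Rewind h b, [keep i, keep out, (u, MoveLeft), keep v])
     else (Scan h b, [keep i, keep out, (u, MoveRight), (u, MoveRight)]))"
| "merge_instr (Rewind h b) [i, out, u, v] =
    (if u = None then (Erase h b, [keep i, keep out, (u, MoveRight), keep v])
     else (Rewind h b, [keep i, keep out, (u, MoveLeft), keep v]))"
| "merge_instr (Erase h b) [i, out, u, v] =
    (if u = Some ItemEnd
     then (after_branch h b,
       [keep i, keep out, (None, MoveRight), (Some (branch_end b), MoveRight)])
     else (Erase h b, [keep i, keep out, (None, MoveRight), (u, MoveRight)]))"
| "merge_instr Close [i, out, u, v] =
    (Open False, [keep i, keep out, keep u, (Some ItemEnd, MoveRight)])"

definition merge_program :: "phase program" where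
  "merge_program = \<lparr>tapes = 4, start = Load, halt = Halt, instr = merge_instr\<rparr>"

lemma merge_program_simps [simp]:
  "tapes merge_program = 4" "start merge_program = Load" "halt merge_program = Halt"
  "instr merge_program = merge_instr"
  by (simp_all add: merge_program_def)

lemma wf_merge_program: "wf_program merge_program"
proof -
  have "length acts = 4 \<and> (acts ! 1 = (rs ! 1, NoMove) \<or> (\<exists>c. acts ! 1 = (Some c, MoveRight)))"
    if "p \<noteq> Halt" "length rs = 4" "merge_instr p rs = (p', acts)" for p p' rs acts
  proof -
    obtain i out u v where "rs = [i, out, u, v]"
      using \<open>length rs = 4\<close> by (auto simp: numeral_eq_Suc length_Suc_conv)
    then show ?thesis
      using that by (cases p) (auto split: if_splits option.splits token.splits)
  qed
  then show ?thesis
    by (auto simp: wf_program_def)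
qed

section \<open>Runs of the program\<close>

abbreviation runs :: "nat \<Rightarrow> phase \<times> zipper list \<Rightarrow> phase \<times> zipper list \<Rightarrow> bool" where
  "runs \<equiv> reaches merge_program"

abbreviation snapshot ::
  "phase \<Rightarrow> token list \<Rightarrow> token list \<Rightarrow> zipper \<Rightarrow> zipper \<Rightarrow> phase \<times> zipper list" where
  "snapshot p inp out z2 z3 \<equiv> (p, [on_right [] inp, on_right out [], z2, z3])"

lemma items_text_simps [simp]:
  "items_text [] = []" "items_text (w # ws) = w @ ItemEnd # items_text ws"
  "items_text (vs @ ws) = items_text vs @ items_text ws"
  by (simp_all add: items_text_def)

abbreviation regexes_text :: "letter regex list \<Rightarrow> token list" where
  "regexes_text rs \<equiv> items_text (map regex_text rs)"

lemma length_items_text_le: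
  "(\<And>w. w \<in> set ws \<Longrightarrow> length w < m) \<Longrightarrow> length (items_text ws) \<le> length ws * m"
  by (induction ws) (auto simp: Suc_le_eq intro: add_less_le_mono)

lemma ItemEnd_notin_regex_text: "ItemEnd \<notin> set (regex_text r)"
  by (induction r) auto

lemma load_run:
  "runs (2 * length w + 1) (snapshot Load (map Letter w @ ItemEnd # inp) out blank blank)
    (snapshot Turn inp out blank
      (on_left (rev (items_text (map (\<lambda>c. [Letter (leaf_letter c)]) w))) []))"
proof -
  let ?item = "\<lambda>c. [Letter (leaf_letter c), ItemEnd]"
  let ?state = "\<lambda>u v. snapshot Load (map Letter u @ ItemEnd # inp) out blank (on_right v [])"
  have "runs (length w * 2) (?state w []) (?state [] (rev (concat (map ?item w)) @ []))"
  proof (rule reaches_concat)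
    fix c u v
    have "runs 1 (?state (c # u) v) (snapshot Separate (map Letter u @ ItemEnd # inp) out blank
        (on_right (Letter (leaf_letter c) # v) []))"
      by (rule reaches_move) simp
    also have "runs 1 \<dots> (?state u (rev (?item c) @ v))"
      by (rule reaches_move) simp
    finally show "runs 2 (?state (c # u) v) (?state u (rev (?item c) @ v))"
      by (simp add: numeral_2_eq_2)
  qed
  also have "runs 1 \<dots> (snapshot Turn inp out blank (on_left (rev (concat (map ?item w))) []))"
    by (rule reaches_move) simp
  finally show ?thesis
    by (simp add: items_text_def o_def mult.commute)
qed

lemma unload_run:
  "runs (length u + 2) (snapshot Turn inp out blank (on_left (ItemEnd # rev u) []))
    (snapshot (if ItemEnd \<in> set u then Open False else Emit) inp out
      (on_right [] (u @ [ItemEnd])) blank)"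
proof -
  let ?state = "\<lambda>l r. snapshot (Unload (ItemEnd \<in> set r)) inp out
    (on_left [] (r @ [ItemEnd])) (on_left l [])"
  have "runs 1 (snapshot Turn inp out blank (on_left (ItemEnd # rev u) [])) (?state (rev u) [])"
    by (rule reaches_move) simp
  also have "runs (length (rev u)) \<dots> (?state [] (rev (rev u) @ []))"
    by (rule reaches_transfer) auto
  also have "runs 1 \<dots> (snapshot (if ItemEnd \<in> set u then Open False else Emit) inp out
      (on_right [] (u @ [ItemEnd])) blank)"
    by (rule reaches_move) simp
  finally show ?thesis
    by simp
qed

abbreviation turn_state ::
  "token list \<Rightarrow> token list \<Rightarrow> letter regex list \<Rightarrow> phase \<times> zipper list" where
  "turn_state inp out rs \<equiv> snapshot Turn inp out blank (on_left (rev (regexes_text rs)) [])"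

abbreviation source_state ::
  "phase \<Rightarrow> token list \<Rightarrow> token list \<Rightarrow> letter regex list \<Rightarrow> phase \<times> zipper list" where
  "source_state p inp out rs \<equiv> snapshot p inp out (on_right [] (regexes_text rs)) blank"

lemma unload_regexes_run:
  assumes "rs \<noteq> []"
  shows "runs (length (regexes_text rs) + 1)
    (turn_state inp out rs)
    (source_state (if length rs = 1 then Emit else Open False) inp out rs)"
proof -
  obtain rs' r where rs: "rs = rs' @ [r]"
    using assms by (metis rev_exhaust)
  have "(if ItemEnd \<in> set (regexes_text rs' @ regex_text r) then Open False else Emit) =
      (if length rs = 1 then Emit else Open False)"
    by (cases rs') (auto simp: rs ItemEnd_notin_regex_text)
  from unload_run[of "regexes_text rs' @ regex_text r" inp out, unfolded this] show ?thesis
    by (simp add: rs)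
qed

lemma emit_run:
  "runs (length u + 1) (snapshot Emit inp out (on_right [] u) blank)
    (snapshot Load inp (rev u @ out) blank blank)"
proof -
  let ?state = "\<lambda>u out. snapshot Emit inp out (on_right [] u) blank"
  have "runs (length u) (?state u out) (?state [] (rev u @ out))"
    by (rule reaches_transfer) simp
  also have "runs 1 \<dots> (snapshot Load inp (rev u @ out) blank blank)"
    by (rule reaches_move) simp
  finally show ?thesis .
qed

lemma copy_run:
  "runs (length inp + 1) (snapshot Copy inp out z2 z3) (snapshot Halt [] (rev inp @ out) z2 z3)"
proof -
  let ?state = "\<lambda>inp out. snapshot Copy inp out z2 z3"
  have "runs (length inp) (?state inp out) (?state [] (rev inp @ out))"
    by (rule reaches_transfer) simp
  also have "runs 1 \<dots> (snapshot Halt [] (rev inp @ out) z2 z3)"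
    by (rule reaches_move) simp
  finally show ?thesis .
qed

lemma branch_run:
  assumes "ItemEnd \<notin> set x" "length x < m"
  shows "runs (3 * m)
    (snapshot (Scan h b) inp out (on_right [] (x @ ItemEnd # r)) (on_right l []))
    (snapshot (after_branch h b) inp out (on_right [] r)
      (on_right (branch_end b # rev (x @ x) @ l) []))"
proof -
  let ?scan = "\<lambda>y v. snapshot (Scan h b) inp out
    (on_right v (y @ ItemEnd # r)) (on_right (v @ l) [])"
  let ?rewind = "\<lambda>y v. snapshot (Rewind h b) inp out
    (on_left y (v @ ItemEnd # r)) (on_right (rev x @ l) [])"
  let ?erase = "\<lambda>y v. snapshot (Erase h b) inp out
    (on_right [] (y @ ItemEnd # r)) (on_right (v @ rev x @ l) [])"
  have "runs (length x) (?scan x []) (?scan [] (rev x @ []))"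
    by (rule reaches_transfer) (use assms(1) in auto)
  also have "runs 1 \<dots> (?rewind (rev x) [])"
    by (rule reaches_move) simp
  also have "runs (length (rev x)) \<dots> (?rewind [] (rev (rev x) @ []))"
    by (rule reaches_transfer) simp
  also have "runs 1 \<dots> (?erase x [])"
    by (rule reaches_move) simp
  also have "runs (length x) \<dots> (?erase [] (rev x @ []))"
    by (rule reaches_transfer) (use assms(1) in auto)
  also have "runs 1 \<dots> (snapshot (after_branch h b) inp out (on_right [] r)
      (on_right (branch_end b # rev (x @ x) @ l) []))"
    by (rule reaches_move) simp
  finally have "runs (3 * m) (?scan x []) (snapshot (after_branch h b) inp out (on_right [] r)
      (on_right (branch_end b # rev (x @ x) @ l) []))"
    by (rule reaches_mono) (use assms(2) in simp)
  then show ?thesis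
    by simp
qed

lemma alternation_run:
  assumes "regex_length r < m" "regex_length s < m"
  shows "runs (6 * m + 1)
    (snapshot (Open h) inp out (on_right [] (regexes_text [r, s] @ w))
      (on_right l []))
    (snapshot (if h then Close else Open True) inp out (on_right [] w)
      (on_right (rev (regex_text (alt_twice r s)) @ l) []))"
proof -
  let ?x = "regex_text r" and ?y = "regex_text s"
  have "runs 1
      (snapshot (Open h) inp out (on_right [] (?x @ ItemEnd # ?y @ ItemEnd # w)) (on_right l []))
      (snapshot (Scan h False) inp out (on_right [] (?x @ ItemEnd # ?y @ ItemEnd # w))
        (on_right (LBrack # l) []))"
    by (rule reaches_move) simp
  also have "runs (3 * m) \<dots>
      (snapshot (after_branch h False) inp out (on_right [] (?y @ ItemEnd # w))
        (on_right (branch_end False # rev (?x @ ?x) @ LBrack # l) []))"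
    using ItemEnd_notin_regex_text assms(1) by (intro branch_run) (simp_all add: regex_length_def)
  also have "after_branch h False = Scan h True"
    by (simp add: after_branch_def)
  also have "runs (3 * m)
      (snapshot (Scan h True) inp out (on_right [] (?y @ ItemEnd # w))
        (on_right (branch_end False # rev (?x @ ?x) @ LBrack # l) []))
      (snapshot (after_branch h True) inp out (on_right [] w)
        (on_right (branch_end True # rev (?y @ ?y) @
          branch_end False # rev (?x @ ?x) @ LBrack # l) []))"
    using ItemEnd_notin_regex_text assms(2) by (intro branch_run) (simp_all add: regex_length_def)
  finally show ?thesis
    by (simp add: alt_twice_def after_branch_def branch_end_def mult.commute)
qed

lemma group_run:
  assumes "\<And>c d. regex_length (f c d) < m"
  shows "runs (12 * m + 3)
    (snapshot (Open False) inp out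
      (on_right [] (regexes_text [f 0 0, f 0 1, f 1 0, f 1 1] @ w)) (on_right l []))
    (snapshot (Open False) inp out (on_right [] w)
      (on_right (rev (regex_text (two_levels f) @ [ItemEnd]) @ l) []))"
proof -
  let ?x = "rev (regex_text (alt_twice (f 0 0) (f 0 1)))"
  let ?y = "rev (regex_text (alt_twice (f 1 0) (f 1 1)))"
  let ?v = "regexes_text [f 1 0, f 1 1] @ w"
  have "runs (6 * m + 1)
      (snapshot (Open False) inp out (on_right [] (regexes_text [f 0 0, f 0 1] @ ?v))
        (on_right l []))
      (snapshot (Open True) inp out (on_right [] ?v) (on_right (?x @ l) []))"
    using alternation_run[of "f 0 0" m "f 0 1" False] assms by simp
  also have "runs (6 * m + 1) \<dots>
      (snapshot Close inp out (on_right [] w) (on_right (?y @ ?x @ l) []))"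
    using alternation_run[of "f 1 0" m "f 1 1" True] assms by simp
  also have "runs 1 \<dots>
      (snapshot (Open False) inp out (on_right [] w) (on_right (ItemEnd # ?y @ ?x @ l) []))"
    by (rule reaches_move) simp
  finally have "runs (12 * m + 3)
      (snapshot (Open False) inp out (on_right [] (regexes_text [f 0 0, f 0 1] @ ?v))
        (on_right l []))
      (snapshot (Open False) inp out (on_right [] w) (on_right (ItemEnd # ?y @ ?x @ l) []))"
    by (rule reaches_mono) simp
  then show ?thesis
    by (simp add: two_levels_def)
qed

lemma pass_run:
  assumes "\<And>i c d. regex_length (f i c d) < m"
  shows "runs (length is * (12 * m + 3) + 1)
    (source_state (Open False) inp out (concat (map (\<lambda>i. [f i 0 0, f i 0 1, f i 1 0, f i 1 1]) is)))
    (turn_state inp out (map (\<lambda>i. two_levels (f i)) is))"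
proof -
  let ?four = "\<lambda>i. [f i 0 0, f i 0 1, f i 1 0, f i 1 1]"
  let ?merged = "\<lambda>i. regex_text (two_levels (f i)) @ [ItemEnd]"
  let ?state = "\<lambda>js v. snapshot (Open False) inp out
    (on_right [] (regexes_text (concat (map ?four js)))) (on_right v [])"
  have "runs (length is * (12 * m + 3)) (?state is [])
      (?state [] (rev (concat (map ?merged is)) @ []))"
  proof (rule reaches_concat)
    fix i js v
    show "runs (12 * m + 3) (?state (i # js) v) (?state js (rev (?merged i) @ v))"
      using group_run[of "f i"] assms by simp
  qed
  also have "runs 1 \<dots> (snapshot Turn inp out blank
      (on_left (rev (concat (map ?merged is))) []))"
    by (rule reaches_move) simp
  finally show ?thesis
    by (simp add: items_text_def o_def)
qed

text \<open>The items that the list holds after \<open>j\<close> passes, with \<open>n\<close> passes to come.\<close>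

definition stage :: "(nat list \<Rightarrow> nat) \<Rightarrow> nat \<Rightarrow> nat \<Rightarrow> letter regex list" where
  "stage a j n = map (\<lambda>i. tensor_regex j (\<lambda>l. a (i @ l))) (index_list (2 * n))"

lemma length_stage [simp]: "length (stage a j n) = 4 ^ n"
  by (simp add: stage_def power_mult)

lemma regexes_text_stage_0_left:
  "regexes_text (stage a 0 k) =
    items_text (map (\<lambda>c. [Letter (leaf_letter c)]) (tensor_word (2 * k) a))"
  by (auto simp: stage_def tensor_word_def leaf_letter_def o_def
      intro!: arg_cong[where f = items_text])

lemma stage_0_right: "stage a j 0 = [tensor_regex j a]"
  by (simp add: stage_def)

lemma stage_Suc_left:
  "stage a (Suc j) n =
    map (\<lambda>i. two_levels (\<lambda>c d. tensor_regex j (\<lambda>l. a (i @ c # d # l)))) (index_list (2 * n))"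
  by (simp add: stage_def)

lemma stage_Suc_right:
  "stage a j (Suc n) = concat (map (\<lambda>i.
    [tensor_regex j (\<lambda>l. a (i @ 0 # 0 # l)), tensor_regex j (\<lambda>l. a (i @ 0 # 1 # l)),
     tensor_regex j (\<lambda>l. a (i @ 1 # 0 # l)), tensor_regex j (\<lambda>l. a (i @ 1 # 1 # l))])
    (index_list (2 * n)))"
  by (simp add: stage_def index_list_Suc_Suc map_concat o_def del: index_list.simps(2))

lemma length_regexes_text_stage: "length (regexes_text (stage a j n)) \<le> 4 ^ n * (2 * 8 ^ j)"
proof -
  have "length (regexes_text (stage a j n)) \<le>
      length (map regex_text (stage a j n)) * (2 * 8 ^ j)"
    using regex_length_tensor_regex_less[of j]
    by (intro length_items_text_le) (auto simp: stage_def regex_length_def)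
  then show ?thesis
    by simp
qed

lemma unload_stage_run:
  "runs (4 ^ n * (2 * 8 ^ j) + 1)
    (turn_state inp out (stage a j n))
    (source_state (if n = 0 then Emit else Open False) inp out (stage a j n))"
proof -
  have "stage a j n \<noteq> []" and single: "(length (stage a j n) = 1) = (n = 0)"
    by (simp_all flip: length_0_conv)
  from unload_regexes_run[OF this(1)] show ?thesis
    unfolding single by (rule reaches_mono) (simp add: length_regexes_text_stage)
qed

lemma stage_run:
  "runs (40 * 4 ^ n * 8 ^ j)
    (turn_state inp out (stage a j (Suc n)))
    (turn_state inp out (stage a (Suc j) n))"
proof -
  have "runs (4 ^ Suc n * (2 * 8 ^ j) + 1)
      (turn_state inp out (stage a j (Suc n)))
      (source_state (Open False) inp out (stage a j (Suc n)))"
    using unload_stage_run[of "Suc n"] by simp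
  also have "runs (length (index_list (2 * n)) * (12 * (2 * 8 ^ j) + 3) + 1) \<dots>
      (turn_state inp out (stage a (Suc j) n))"
    unfolding stage_Suc_left stage_Suc_right
    by (intro pass_run regex_length_tensor_regex_less)
  finally show ?thesis
  proof (rule reaches_mono)
    have index: "length (index_list (2 * n)) = 4 ^ n"
      by (simp add: power_mult)
    have "4 ^ Suc n * (2 * 8 ^ j) + 1 +
        (length (index_list (2 * n)) * (12 * (2 * 8 ^ j) + 3) + 1) =
        32 * (4 ^ n * 8 ^ j) + 3 * 4 ^ n + 2"
      unfolding index by (simp add: algebra_simps)
    also have "\<dots> \<le> 40 * (4 ^ n * 8 ^ j)"
      using mult_le_mono2[of 1 "8 ^ j" "4 ^ n"] one_le_power[of "4 :: nat" n]
        one_le_power[of "8 :: nat" j]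
      by linarith
    finally show "4 ^ Suc n * (2 * 8 ^ j) + 1 +
        (length (index_list (2 * n)) * (12 * (2 * 8 ^ j) + 3) + 1) \<le> 40 * 4 ^ n * 8 ^ j"
      by (simp add: mult.assoc)
  qed
qed

lemma merge_run:
  "runs (5 * 16 ^ n * 8 ^ j)
    (turn_state inp out (stage a j n))
    (source_state Emit inp out [tensor_regex (j + n) a])"
proof (induction n arbitrary: j)
  case 0
  have "runs (2 * 8 ^ j + 1) (turn_state inp out (stage a j 0))
      (source_state Emit inp out (stage a j 0))"
    using unload_stage_run[of 0] by simp
  moreover have "2 * 8 ^ j + 1 \<le> (5 * 16 ^ 0 * 8 ^ j :: nat)"
    using one_le_power[of "8 :: nat" j] by simp
  ultimately show ?case
    unfolding stage_0_right add_0_right by (rule reaches_mono)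
next
  case (Suc n)
  have "runs (40 * 4 ^ n * 8 ^ j)
      (turn_state inp out (stage a j (Suc n)))
      (turn_state inp out (stage a (Suc j) n))"
    by (rule stage_run)
  also have "runs (5 * 16 ^ n * 8 ^ Suc j) \<dots>
      (source_state Emit inp out [tensor_regex (Suc j + n) a])"
    by (rule Suc.IH)
  finally have "runs (40 * 4 ^ n * 8 ^ j + 5 * 16 ^ n * 8 ^ Suc j)
      (turn_state inp out (stage a j (Suc n)))
      (source_state Emit inp out [tensor_regex (j + Suc n) a])"
    by simp
  moreover have "40 * 4 ^ n * 8 ^ j + 5 * 16 ^ n * 8 ^ Suc j \<le> (5 * 16 ^ Suc n * 8 ^ j :: nat)"
    using power_mono[of "4 :: nat" 16 n] by simp
  ultimately show ?case
    by (rule reaches_mono)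
qed

lemma tensor_run:
  "runs (11 * 16 ^ k) (snapshot Load (tensor_text (2 * k) a @ ItemEnd # inp) out blank blank)
    (snapshot Load inp (rev (regex_text (tensor_regex k a) @ [ItemEnd]) @ out) blank blank)"
proof -
  let ?x = "regexes_text [tensor_regex k a]"
  have "runs (2 * length (tensor_word (2 * k) a) + 1)
      (snapshot Load (tensor_text (2 * k) a @ ItemEnd # inp) out blank blank)
      (turn_state inp out (stage a 0 k))"
    unfolding tensor_text_word regexes_text_stage_0_left by (rule load_run)
  also have "runs (5 * 16 ^ k) \<dots> (source_state Emit inp out [tensor_regex k a])"
    using merge_run[of k 0] by simp
  also have "runs (length ?x + 1) \<dots> (snapshot Load inp (rev ?x @ out) blank blank)"
    by (rule emit_run)
  finally have "runs (11 * 16 ^ k)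
      (snapshot Load (tensor_text (2 * k) a @ ItemEnd # inp) out blank blank)
      (snapshot Load inp (rev ?x @ out) blank blank)"
  proof (rule reaches_mono)
    have "length ?x \<le> 2 * 8 ^ k"
      using regex_length_tensor_regex_less[of k a] by (simp add: regex_length_def)
    moreover have "length (tensor_word (2 * k) a) = 4 ^ k"
      by (simp add: power_mult)
    ultimately show "2 * length (tensor_word (2 * k) a) + 1 + 5 * 16 ^ k + (length ?x + 1)
        \<le> 11 * 16 ^ k"
      using power_mono[of "4 :: nat" 16 k] power_mono[of "8 :: nat" 16 k]
        one_le_power[of "16 :: nat" k]
      by linarith
  qed
  then show ?thesis
    by simp
qed

lemma tensors_run:
  "runs (length as * (11 * 16 ^ k))
    (snapshot Load (items_text (map (tensor_text (2 * k)) as) @ inp) out blank blank)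
    (snapshot Load inp
      (rev (regexes_text (map (tensor_regex k) as)) @ out) blank blank)"
proof -
  let ?item = "\<lambda>a. regex_text (tensor_regex k a) @ [ItemEnd]"
  let ?state = "\<lambda>as out. snapshot Load
    (items_text (map (tensor_text (2 * k)) as) @ inp) out blank blank"
  have "runs (length as * (11 * 16 ^ k)) (?state as out)
      (?state [] (rev (concat (map ?item as)) @ out))"
    by (rule reaches_concat) (use tensor_run in simp)
  then show ?thesis
    by (simp add: items_text_def o_def)
qed

lemma length_items_text_tensors:
  "length (items_text (map (tensor_text (2 * k)) bs)) \<le> 2 * (length bs * 16 ^ k)"
proof -
  have "length (items_text (map (tensor_text (2 * k)) bs)) \<le>
      length (map (tensor_text (2 * k)) bs) * (4 ^ k + 1)"
    by (rule length_items_text_le) (auto simp: tensor_text_word power_mult)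
  also have "\<dots> \<le> length bs * (2 * 16 ^ k)"
    unfolding length_map using power_mono[of "4 :: nat" 16 k] one_le_power[of "16 :: nat" k]
    by (intro mult_left_mono) linarith+
  finally show ?thesis
    by simp
qed

lemma merge_program_computes:
  assumes "length bs = length as" "1 \<le> length as"
  shows "program_computes merge_program (input_text (2 * k) as bs)
    (output_text (map (tensor_regex k) as) (map (tensor_word (2 * k)) bs))
    (15 * length as * 16 ^ k)"
proof -
  let ?N = "length as"
  let ?a = "regexes_text (map (tensor_regex k) as)"
  let ?b = "items_text (map (tensor_text (2 * k)) bs)"
  have "runs (?N * (11 * 16 ^ k)) (snapshot Load (input_text (2 * k) as bs) [] blank blank)
      (snapshot Load (ListEnd # ?b) (rev ?a @ []) blank blank)"
    using tensors_run[of as k "ListEnd # ?b" "[]"] by (simp add: input_text_def)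
  also have "runs 1 \<dots> (snapshot Copy ?b (ListEnd # rev ?a) blank blank)"
    by (rule reaches_move) simp
  also have "runs (length ?b + 1) \<dots> (snapshot Halt [] (rev ?b @ ListEnd # rev ?a) blank blank)"
    by (rule copy_run)
  also have "rev ?b @ ListEnd # rev ?a =
      rev (output_text (map (tensor_regex k) as) (map (tensor_word (2 * k)) bs))"
    by (simp add: output_text_def o_def flip: tensor_text_word)
  finally have "runs (15 * ?N * 16 ^ k) (snapshot Load (input_text (2 * k) as bs) [] blank blank)
      (snapshot Halt []
        (rev (output_text (map (tensor_regex k) as) (map (tensor_word (2 * k)) bs))) blank blank)"
  proof (rule reaches_mono)
    have "1 \<le> ?N * 16 ^ k"
      using assms(2) by simp
    then show "?N * (11 * 16 ^ k) + 1 + (length ?b + 1) \<le> 15 * ?N * 16 ^ k"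
      using length_items_text_tensors[of k bs] unfolding assms(1) by linarith
  qed
  then show ?thesis
    unfolding program_computes_def by (intro exI conjI) (auto simp: numeral_eq_Suc)
qed

theorem theorem7p1:
  "\<exists>M C k C' k'. wf_machine M \<and>
    (\<forall>t N A B as bs.
       even t \<and> 1 \<le> N \<and>
       A \<subseteq> tensors t \<and> card A = N \<and>
       B \<subseteq> tensors t \<and> card B = N \<and> (\<forall>b \<in> B. max_invariant t b) \<and>
       distinct as \<and> set as = A \<and> distinct bs \<and> set bs = B \<longrightarrow>
       (\<exists>f g A' B'.
          computes_within M (input_text t as bs) (output_text (map f as) (map g bs))
            (C * N * (2 ^ t) ^ k) \<and>
          bij_betw f A A' \<and> card A' = N \<and> inj_on regex_text A' \<and>
          (\<forall>r \<in> A'. regex_length r \<le> C' * (2 ^ t) ^ k') \<and>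
          bij_betw g B B' \<and> card B' = N \<and> (\<forall>w \<in> B'. length w = 2 ^ t) \<and>
          (\<forall>a \<in> A. \<forall>b \<in> B.
             (\<exists>x \<in> lang (f a). length x = length (g b)) \<and>
             MaxSim (f a) (g b) = trop_sim t a b)))"
proof -
  obtain M where M: "wf_machine M" "\<And>inp out T. program_computes merge_program inp out T \<Longrightarrow>
      computes_within M inp out T"
    using program_computable[OF wf_merge_program] by blast
  show ?thesis
  proof (rule exI[of _ M], rule exI[of _ 15], rule exI[of _ 2], rule exI[of _ 2], rule exI[of _ 2],
      intro conjI allI impI, rule M(1), goal_cases)
    case prems: (1 t N A B as bs)
    then obtain k where t: "t = 2 * k"
      by blast
    have "inj_on (\<lambda>a. regex_text (tensor_regex k a)) A" "inj_on (tensor_word t) B"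
      using prems t inj_tensor_regex_text inj_tensor_word inj_on_subset by blast+
    then have inj: "inj_on (tensor_regex k) A" "inj_on regex_text (tensor_regex k ` A)"
      "inj_on (tensor_word t) B"
      by (auto simp: inj_on_def)
    have "length as = N" "length bs = N"
      using prems distinct_card by metis+
    then have "computes_within M (input_text t as bs)
        (output_text (map (tensor_regex k) as) (map (tensor_word t) bs)) (15 * N * (2 ^ t) ^ 2)"
      using M(2)[OF merge_program_computes[of bs as k]] prems
      by (simp add: t square_two_power_double)
    then show ?case
      using inj prems regex_length_tensor_regex_le[of k] MaxSim_tensor_regex[of _ k]
      by (intro exI[of _ "tensor_regex k"] exI[of _ "tensor_word t"]
          exI[of _ "tensor_regex k ` A"] exI[of _ "tensor_word t ` B"])
        (auto simp: t inj_on_imp_bij_betw card_image subset_iff)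
  qed
qed

end
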